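(* Fix $p\in(0,1)$ and put $q=1-p$. Let $T_{n,p}$ be the post-loss completion time of the careless coupon collector on $n$ types started from the empty collection, let $\nu_n$ be the stationary law of the count chain $K_t=|S_t|$, and let $\mu_n:=\mathbb P_{\nu_n}(K_0<n,K_1=n)$. Then $\mu_nT_{n,p}\Rightarrow\mathrm{Exp}(1)$, and moreover $\mu_n\sim\frac{1}{(q;q)_\infty}\frac{n!}{n^n}q^{n(n+1)/2}$ as $n\to\infty$.
   Context: Careless coupon collector (post-loss convention): $S_t\subseteq[n]$ is the set of held coupons after round $t$, $S_0=\emptyset$. In round $t$, a type $J_t$ is drawn uniformly from $[n]$ independently of the past, and then each coupon of $S_t\cup\{J_t\}$ is independently lost with probability $p$; $S_{t+1}$ is the set of survivors. $K_t=|S_t|$ is then an irreducible aperiodic Markov chain on $\{0,\dots,n\}$ with unique stationary law $\nu_n$. $T_{n,p}=\inf\{t\ge0:S_t=[n]\}$. $(q;q)_\infty:=\prod_{r=1}^\infty(1-q^r)$. $\mathrm{Exp}(1)$ is the exponential law with mean 1. *)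

theory Defs
  imports "HOL-Probability.Probability" "HOL-Library.Landau_Symbols"
begin

text \<open>Coupon types are [n] = {0..<n}. One round's randomness: the drawn type J
  and independent loss flags (lost with probability p) for every type in [n].\<close>
definition round_pmf :: "nat \<Rightarrow> real \<Rightarrow> (nat \<times> (nat \<Rightarrow> bool)) pmf" where
  "round_pmf n p = pair_pmf (pmf_of_set {0..<n}) (Pi_pmf {0..<n} False (\<lambda>_. bernoulli_pmf p))"

definition ccc_space :: "nat \<Rightarrow> real \<Rightarrow> (nat \<Rightarrow> nat \<times> (nat \<Rightarrow> bool)) measure" where
  "ccc_space n p = PiM UNIV (\<lambda>_. measure_pmf (round_pmf n p))"

text \<open>Held coupons after round t (post-loss convention), S_0 = empty.\<close>
fun ccc_S :: "(nat \<Rightarrow> nat \<times> (nat \<Rightarrow> bool)) \<Rightarrow> nat \<Rightarrow> nat set" where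
  "ccc_S \<omega> 0 = {}"
| "ccc_S \<omega> (Suc t) = {x \<in> insert (fst (\<omega> t)) (ccc_S \<omega> t). \<not> snd (\<omega> t) x}"

definition ccc_T :: "nat \<Rightarrow> (nat \<Rightarrow> nat \<times> (nat \<Rightarrow> bool)) \<Rightarrow> nat" where
  "ccc_T n \<omega> = (LEAST t. ccc_S \<omega> t = {0..<n})"

definition set_step :: "nat \<Rightarrow> real \<Rightarrow> nat set \<Rightarrow> nat set pmf" where
  "set_step n p S = bind_pmf (round_pmf n p)
      (\<lambda>(j, lost). return_pmf {x \<in> insert j S. \<not> lost x})"

text \<open>Transition kernel of the count chain K_t = |S_t| (from any set of size k;
  we use the representative {0..<k}).\<close>
definition count_step :: "nat \<Rightarrow> real \<Rightarrow> nat \<Rightarrow> nat pmf" where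
  "count_step n p k = map_pmf card (set_step n p {0..<k})"

definition count_stationary :: "nat \<Rightarrow> real \<Rightarrow> nat pmf \<Rightarrow> bool" where
  "count_stationary n p \<nu> \<longleftrightarrow> set_pmf \<nu> \<subseteq> {0..n} \<and> bind_pmf \<nu> (count_step n p) = \<nu>"

definition nu :: "nat \<Rightarrow> real \<Rightarrow> nat pmf" where
  "nu n p = (THE \<nu>. count_stationary n p \<nu>)"

definition mu :: "nat \<Rightarrow> real \<Rightarrow> real" where
  "mu n p = measure_pmf.prob
      (bind_pmf (nu n p) (\<lambda>k. map_pmf (\<lambda>k'. (k, k')) (count_step n p k)))
      {(a, b). a < n \<and> b = n}"

definition qpoch_inf :: "real \<Rightarrow> real" where
  "qpoch_inf q = (\<Prod>r. 1 - q ^ (Suc r))"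

end

theory Submission
  imports Defs
begin

text \<open>
  If \<open>A\<close> is the current collection, the expected number of \<open>(m + 1)\<close>-subsets held after one round
  is \<open>q^(m+1) ((1 - (m+1)/n) C(|A|, m+1) + (n-m)/n C(|A|, m))\<close>, so the binomial moments obey a closed
  triangular linear recursion. Its fixed point is the stationary law, and it gives exactly
  \<open>\<nu>(n) = n!/n^n q^(n(n+1)/2) / \<Prod>i=1..n. (1 - (1 - i/n) q^i)\<close>, while flow balance gives
  \<open>\<mu> = (1 - q^n) \<nu>(n)\<close>. The same recursion shows that the occupation probabilities of the full state,
  started from the empty or from the full collection, differ from \<open>\<nu>(n)\<close> by a sequence whose sum, apart
  from the initial term of the full start, is \<open>O(q^n)\<close>. Summing the renewal equation over time then yields
  \<open>G(N) + \<nu>(n) (\<Sum>k\<le>N. G(k)) = 1 + O(q^n)\<close> uniformly in \<open>N\<close> for the tail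
  \<open>G(N) = P(T > N)\<close>. The exact solution without the error term is \<open>(1 + \<nu>(n))^-(N+1)\<close>, and the
  equation is stable, so \<open>G\<close> is uniformly \<open>O(q^n)\<close>-close to this geometric tail.
\<close>

section \<open>One round of the chain\<close>

text \<open>A round as a deterministic map of its randomness. The count kernel is a pushforward
  under it and the path is its iteration, so both descriptions share one function.\<close>

definition upd :: "nat \<times> (nat \<Rightarrow> bool) \<Rightarrow> nat set \<Rightarrow> nat set" where
  "upd r S = {x \<in> insert (fst r) S. \<not> snd r x}"

lemma set_step_eq: "set_step n p S = map_pmf (\<lambda>r. upd r S) (round_pmf n p)"
  by (simp add: set_step_def map_pmf_def upd_def split_def)

lemma count_step_eq: "count_step n p k = map_pmf (\<lambda>r. card (upd r {0..<k})) (round_pmf n p)"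
  by (simp add: count_step_def set_step_eq map_pmf_comp)

lemma finite_set_Pi_pmf_bool:
  assumes "finite I"
  shows "finite (set_pmf (Pi_pmf I d (P :: _ \<Rightarrow> bool pmf)))"
proof (rule finite_subset)
  show "set_pmf (Pi_pmf I d P) \<subseteq> PiE_dflt I d (set_pmf \<circ> P)"
    by (rule set_Pi_pmf_subset'[OF assms])
  show "finite (PiE_dflt I d (set_pmf \<circ> P))"
    using assms by (intro finite_PiE_dflt) auto
qed

text \<open>With k = card S, a held type leaves C(k, m+1) and a new one adds C(k, m) by Pascal's
  rule. The absorption identity (k-m) C(k, m) = (m+1) C(k, m+1) then removes k from the
  coefficients, which is what closes the moment recursion.\<close>

lemma sum_choose_insert:
  assumes "S \<subseteq> {0..<n}"
  shows "(\<Sum>j<n. real (card (insert j S) choose Suc m))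
      = (real n - real (Suc m)) * real (card S choose Suc m) + (real n - real m) * real (card S choose m)"
proof -
  have fin: "finite S" using assms finite_subset by blast
  have le: "card S \<le> n" using card_mono[OF _ assms] by simp
  define k where "k = card S"
  have "(\<Sum>j<n. real (card (insert j S) choose Suc m))
      = (\<Sum>j\<in>S. real (card (insert j S) choose Suc m)) + (\<Sum>j\<in>{0..<n} - S. real (card (insert j S) choose Suc m))"
    using assms by (subst sum.subset_diff[of S "{..<n}"]) (auto simp: lessThan_atLeast0)
  also have "(\<Sum>j\<in>S. real (card (insert j S) choose Suc m)) = real k * real (k choose Suc m)"
    by (simp add: insert_absorb k_def)
  also have "(\<Sum>j\<in>{0..<n} - S. real (card (insert j S) choose Suc m))
      = (real n - real k) * (real (k choose Suc m) + real (k choose m))"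
    using fin assms le by (simp add: k_def card_Diff_subset of_nat_diff)
  also have "real k * real (k choose Suc m) + (real n - real k) * (real (k choose Suc m) + real (k choose m))
      = real n * real (k choose Suc m) + (real n - real m) * real (k choose m)
        - (real k - real m) * real (k choose m)"
    by (simp add: algebra_simps)
  also have "(real k - real m) * real (k choose m) = real (Suc m) * real (k choose Suc m)"
  proof (cases "m \<le> k")
    case True
    have "(k choose m) * (k - m) = Suc m * (k choose Suc m)"
      by (simp only: binomial_absorption mult.commute[of _ "k - m"] binomial_absorb_comp)
    then show ?thesis using True by (metis mult.commute of_nat_diff of_nat_mult)
  next
    case False
    then show ?thesis by (simp add: binomial_eq_0)
  qed
  finally show ?thesis by (simp add: k_def algebra_simps)
qed

section \<open>Averages of binomial coefficients over one round\<close>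

locale ccc =
  fixes n :: nat and p q :: real
  assumes n_pos: "0 < n" and p_pos: "0 < p" and p_less_1: "p < 1" and q_def: "q = 1 - p"
begin

abbreviation "full \<equiv> {0..<n}"

text \<open>The Markov operator of the set-valued chain. Its iterates give expectations after
  several rounds without any path space.\<close>

definition avg :: "(nat set \<Rightarrow> real) \<Rightarrow> nat set \<Rightarrow> real" where
  "avg g S = measure_pmf.expectation (round_pmf n p) (\<lambda>r. g (upd r S))"

lemma q_pos: "0 < q" and q_less_1: "q < 1"
  using p_pos p_less_1 by (auto simp: q_def)

lemma set_round: "r \<in> set_pmf (round_pmf n p) \<Longrightarrow> fst r < n"
  using n_pos by (auto simp: round_pmf_def)

text \<open>\<open>Pi_pmf\<close> fixes the loss flags outside [n] to \<open>False\<close>, so one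
  round has finitely many outcomes and every expectation is a finite sum.\<close>

lemma finite_set_round [simp]: "finite (set_pmf (round_pmf n p))"
  using n_pos by (auto simp: round_pmf_def intro!: finite_set_Pi_pmf_bool)

lemma upd_subset:
  "S \<subseteq> full \<Longrightarrow> r \<in> set_pmf (round_pmf n p) \<Longrightarrow> upd r S \<subseteq> full"
  using set_round[of r] by (auto simp: upd_def)

lemma avg_sum: "avg g S = (\<Sum>r\<in>set_pmf (round_pmf n p). pmf (round_pmf n p) r * g (upd r S))"
  unfolding avg_def by (subst integral_measure_pmf[of "set_pmf (round_pmf n p)"]) auto

lemma avg_cong:
  "S \<subseteq> full \<Longrightarrow> (\<And>A. A \<subseteq> full \<Longrightarrow> g A = h A) \<Longrightarrow> avg g S = avg h S"
  unfolding avg_sum by (auto intro!: sum.cong dest: upd_subset)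

lemma avg_mono:
  "S \<subseteq> full \<Longrightarrow> (\<And>A. A \<subseteq> full \<Longrightarrow> g A \<le> h A) \<Longrightarrow> avg g S \<le> avg h S"
  unfolding avg_sum by (auto intro!: sum_mono mult_left_mono dest: upd_subset)

lemma avg_const [simp]: "avg (\<lambda>_. c) S = c"
  by (simp add: avg_def)

lemma avg_lin: "avg (\<lambda>A. a * g A + b * h A) S = a * avg g S + b * avg h S"
  unfolding avg_sum by (simp add: sum_distrib_left sum.distrib algebra_simps)

lemma avg_sum_swap: "avg (\<lambda>A. \<Sum>i\<in>I. g i A) S = (\<Sum>i\<in>I. avg (g i) S)"
  unfolding avg_sum sum_distrib_left by (rule sum.swap)

lemma avg_mult_right: "avg (\<lambda>A. g A * c) S = avg g S * c"
  unfolding avg_sum by (simp add: sum_distrib_right mult.assoc)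

lemma prob_survive:
  assumes "U \<subseteq> full"
  shows "measure_pmf.prob (Pi_pmf full False (\<lambda>_. bernoulli_pmf p)) {f. \<forall>x\<in>U. \<not> f x} = q ^ card U"
proof -
  have "{f. \<forall>x\<in>U. \<not> f x} = Pi full (\<lambda>x. if x \<in> U then {False} else UNIV)"
    using assms by (auto simp: Pi_def)
  then have "measure_pmf.prob (Pi_pmf full False (\<lambda>_. bernoulli_pmf p)) {f. \<forall>x\<in>U. \<not> f x}
     = (\<Prod>x\<in>full. measure_pmf.prob (bernoulli_pmf p) (if x \<in> U then {False} else UNIV))"
    by (simp add: measure_Pi_pmf_Pi)
  also have "\<dots> = (\<Prod>x\<in>full. if x \<in> U then q else 1)"
    using p_pos p_less_1 by (intro prod.cong refl) (auto simp: measure_pmf_single q_def)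
  also have "\<dots> = q ^ card U"
    using assms by (simp add: prod.If_cases Int_absorb1)
  finally show ?thesis .
qed

text \<open>The surviving m-subsets are counted by a sum of indicators over the m-subsets of S, each
  surviving with probability q^m, and linearity of expectation does the rest.\<close>

lemma thinning_choose:
  assumes "S \<subseteq> full"
  shows "measure_pmf.expectation (Pi_pmf full False (\<lambda>_. bernoulli_pmf p))
      (\<lambda>f. real (card {x \<in> S. \<not> f x} choose m)) = q ^ m * real (card S choose m)"
proof -
  let ?M = "Pi_pmf full False (\<lambda>_. bernoulli_pmf p)"
  have fin: "finite S" using assms finite_subset by blast
  have "real (card {x \<in> S. \<not> f x} choose m)
      = (\<Sum>U | U \<subseteq> S \<and> card U = m. indicator {f. \<forall>x\<in>U. \<not> f x} f)" for f
  proof -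
    have "real (card {x \<in> S. \<not> f x} choose m) = real (card {U. U \<subseteq> {x \<in> S. \<not> f x} \<and> card U = m})"
      using fin by (subst n_subsets) auto
    also have "{U. U \<subseteq> {x \<in> S. \<not> f x} \<and> card U = m} = {U. U \<subseteq> S \<and> card U = m} \<inter> {U. \<forall>x\<in>U. \<not> f x}"
      by auto
    also have "real (card \<dots>) = (\<Sum>U | U \<subseteq> S \<and> card U = m. indicator {U. \<forall>x\<in>U. \<not> f x} U)"
      using fin by (simp add: indicator_def sum.If_cases)
    finally show ?thesis by (simp add: indicator_def)
  qed
  then have "measure_pmf.expectation ?M (\<lambda>f. real (card {x \<in> S. \<not> f x} choose m))
      = (\<Sum>U | U \<subseteq> S \<and> card U = m. measure_pmf.prob ?M {f. \<forall>x\<in>U. \<not> f x})"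
    by (simp only:) (subst Bochner_Integration.integral_sum,
      auto intro!: integrable_measure_pmf_finite finite_set_Pi_pmf_bool)
  also have "\<dots> = (\<Sum>U | U \<subseteq> S \<and> card U = m. q ^ m)"
    using assms by (intro sum.cong refl) (auto simp: prob_survive)
  also have "\<dots> = q ^ m * real (card S choose m)"
    using fin by (simp add: n_subsets)
  finally show ?thesis .
qed

text \<open>Conditionally on the drawn type, thinning contributes the factor q^(m+1); averaging over
  the type is then \<open>sum_choose_insert\<close> divided by n.\<close>

lemma avg_choose:
  assumes "S \<subseteq> full"
  shows "avg (\<lambda>A. real (card A choose Suc m)) S
     = q ^ Suc m * ((1 - real (Suc m) / n) * real (card S choose Suc m)
                    + (real n - real m) / n * real (card S choose m))"
proof -
  let ?M = "Pi_pmf full False (\<lambda>_. bernoulli_pmf p)"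
  have "avg (\<lambda>A. real (card A choose Suc m)) S
     = (\<Sum>j<n. measure_pmf.expectation (map_pmf (Pair j) ?M)
          (\<lambda>r. real (card (upd r S) choose Suc m))) / n"
    unfolding avg_def round_pmf_def pair_pmf_def map_pmf_def[symmetric]
    using n_pos by (subst pmf_expectation_bind_pmf_of_set)
      (auto simp: finite_set_Pi_pmf_bool lessThan_atLeast0 sum_divide_distrib sum_distrib_left divide_inverse mult.commute)
  also have "(\<Sum>j<n. measure_pmf.expectation (map_pmf (Pair j) ?M)
          (\<lambda>r. real (card (upd r S) choose Suc m)))
      = (\<Sum>j<n. q ^ Suc m * real (card (insert j S) choose Suc m))"
  proof (intro sum.cong refl)
    fix j assume "j \<in> {..<n}"
    then have "insert j S \<subseteq> full" using assms by auto
    from thinning_choose[OF this, of "Suc m"]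
    show "measure_pmf.expectation (map_pmf (Pair j) ?M) (\<lambda>r. real (card (upd r S) choose Suc m))
       = q ^ Suc m * real (card (insert j S) choose Suc m)"
      by (simp add: upd_def)
  qed
  also have "\<dots> = q ^ Suc m * ((real n - real (Suc m)) * real (card S choose Suc m)
      + (real n - real m) * real (card S choose m))"
    by (simp only: sum_distrib_left[symmetric] sum_choose_insert[OF assms])
  finally have "avg (\<lambda>A. real (card A choose Suc m)) S = q ^ Suc m * ((real n - real (Suc m)) * real (card S choose Suc m)
      + (real n - real m) * real (card S choose m)) / n" .
  moreover have "1 - real (Suc m) / n = (real n - real (Suc m)) / n"
    using n_pos by (simp add: diff_divide_distrib)
  ultimately show ?thesis
    by (simp only: add_divide_distrib[symmetric] times_divide_eq_left times_divide_eq_right)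
qed

end

section \<open>Stationary law\<close>

context ccc
begin

definition moment :: "nat pmf \<Rightarrow> nat \<Rightarrow> real" where
  "moment \<kappa> m = measure_pmf.expectation \<kappa> (\<lambda>k. real (k choose m))"

text \<open>The fixed point of the recursion in \<open>moment_step\<close>: the equation x =
  \<alpha> x + \<gamma> y is solved for the new moment x, with y the previous one.\<close>

fun stat_moment :: "nat \<Rightarrow> real" where
  "stat_moment 0 = 1"
| "stat_moment (Suc m) = q ^ Suc m * ((real n - real m) / n) * stat_moment m
     / (1 - q ^ Suc m * (1 - real (Suc m) / n))"

text \<open>Nonnegativity drives the monotonicity argument in \<open>moment_incseq\<close>; the
  strict bound makes the fixed-point equation for the moments uniquely solvable.\<close>

lemma damping_less_1:
  assumes "m < n"
  shows "0 \<le> q ^ Suc m * (1 - real (Suc m) / n)" and "q ^ Suc m * (1 - real (Suc m) / n) < 1"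
proof -
  have frac: "0 \<le> 1 - real (Suc m) / n" "1 - real (Suc m) / n < 1"
    using assms by (auto simp: divide_simps)
  have "0 < q ^ Suc m" "q ^ Suc m < 1"
    using q_pos q_less_1 by (auto intro!: power_Suc_less_one simp del: power_Suc)
  then show "0 \<le> q ^ Suc m * (1 - real (Suc m) / n)" "q ^ Suc m * (1 - real (Suc m) / n) < 1"
    using frac mult_strict_mono[of "q ^ Suc m" 1 "1 - real (Suc m) / n" 1] by auto
qed

lemma expectation_finite:
  assumes "set_pmf \<kappa> \<subseteq> {0..n}"
  shows "measure_pmf.expectation \<kappa> (g :: nat \<Rightarrow> real) = (\<Sum>k\<in>{0..n}. pmf \<kappa> k * g k)"
  using assms by (subst integral_measure_pmf[of "{0..n}"]) auto

lemma moment_0: "moment \<kappa> 0 = 1"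
  by (simp add: moment_def)

text \<open>C(k, n) vanishes for k < n, so the top moment is the probability of a complete
  collection. This is how moment formulas yield the quantities of interest.\<close>

lemma moment_top:
  assumes "set_pmf \<kappa> \<subseteq> {0..n}"
  shows "moment \<kappa> n = pmf \<kappa> n"
proof -
  have "moment \<kappa> n = (\<Sum>k\<in>{0..n}. if k = n then pmf \<kappa> n else 0)"
    unfolding moment_def expectation_finite[OF assms]
    by (intro sum.cong refl) (auto simp: binomial_eq_0)
  then show ?thesis by simp
qed

lemma set_count_step:
  assumes "k \<le> n"
  shows "set_pmf (count_step n p k) \<subseteq> {0..n}"
proof
  fix x assume "x \<in> set_pmf (count_step n p k)"
  then obtain r where r: "r \<in> set_pmf (round_pmf n p)" "x = card (upd r {0..<k})"
    by (auto simp: count_step_eq)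
  have "upd r {0..<k} \<subseteq> full"
    using assms by (intro upd_subset r) auto
  then show "x \<in> {0..n}"
    using card_mono[of full "upd r {0..<k}"] r by auto
qed

lemma set_bind_count_step:
  "set_pmf \<kappa> \<subseteq> {0..n} \<Longrightarrow> set_pmf (bind_pmf \<kappa> (count_step n p)) \<subseteq> {0..n}"
  using set_count_step by fastforce

lemma moment_count_step:
  assumes "k \<le> n"
  shows "moment (count_step n p k) (Suc m)
     = q ^ Suc m * ((1 - real (Suc m) / n) * real (k choose Suc m)
                    + (real n - real m) / n * real (k choose m))"
  using avg_choose[of "{0..<k}" m] assms by (simp add: moment_def count_step_eq avg_def)

lemma moment_step:
  assumes "set_pmf \<kappa> \<subseteq> {0..n}"
  shows "moment (bind_pmf \<kappa> (count_step n p)) (Suc m)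
     = q ^ Suc m * (1 - real (Suc m) / n) * moment \<kappa> (Suc m)
       + q ^ Suc m * ((real n - real m) / n) * moment \<kappa> m"
proof -
  have "moment (bind_pmf \<kappa> (count_step n p)) (Suc m)
     = (\<Sum>k\<in>{0..n}. pmf \<kappa> k * moment (count_step n p k) (Suc m))"
    unfolding moment_def
    by (subst pmf_expectation_bind[of "{0..n}"])
       (use assms finite_subset[OF set_count_step] in auto)
  also have "\<dots> = (\<Sum>k\<in>{0..n}. pmf \<kappa> k * (q ^ Suc m * ((1 - real (Suc m) / n) * real (k choose Suc m)
                    + (real n - real m) / n * real (k choose m))))"
    by (intro sum.cong refl) (simp only: moment_count_step atLeastAtMost_iff)
  also have "\<dots> = q ^ Suc m * (1 - real (Suc m) / n) * moment \<kappa> (Suc m)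
       + q ^ Suc m * ((real n - real m) / n) * moment \<kappa> m"
    unfolding moment_def expectation_finite[OF assms] sum_distrib_left sum.distrib[symmetric]
    by (intro sum.cong refl) (simp only: ring_distribs mult_ac)
  finally show ?thesis .
qed

lemma stationary_moment:
  assumes "count_stationary n p \<kappa>" "m \<le> n"
  shows "moment \<kappa> m = stat_moment m"
  using \<open>m \<le> n\<close>
proof (induction m)
  case 0
  then show ?case by (simp add: moment_0)
next
  case (Suc m)
  define \<alpha> where "\<alpha> = q ^ Suc m * (1 - real (Suc m) / n)"
  define \<gamma> where "\<gamma> = q ^ Suc m * ((real n - real m) / n)"
  have "moment \<kappa> (Suc m) = \<alpha> * moment \<kappa> (Suc m) + \<gamma> * moment \<kappa> m"
    using moment_step[of \<kappa> m] assms(1) by (simp only: count_stationary_def \<alpha>_def \<gamma>_def)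
  moreover have "\<alpha> < 1"
    using damping_less_1(2)[of m] Suc.prems by (simp only: \<alpha>_def)
  ultimately have "moment \<kappa> (Suc m) = \<gamma> * moment \<kappa> m / (1 - \<alpha>)"
    by (simp add: field_simps)
  then show ?case
    using Suc by (simp only: stat_moment.simps \<alpha>_def \<gamma>_def)
qed

text \<open>The matrix C(k, m) is unitriangular, so point masses are recovered from moments by back
  substitution from k = n downwards. This serves both uniqueness and convergence of the
  laws.\<close>

lemma pmf_eq_moment_minus:
  assumes "set_pmf \<kappa> \<subseteq> {0..n}" "m \<le> n"
  shows "pmf \<kappa> m = moment \<kappa> m - (\<Sum>k\<in>{m<..n}. pmf \<kappa> k * real (k choose m))"
proof -
  have "moment \<kappa> m = (\<Sum>k\<in>{0..n}. pmf \<kappa> k * real (k choose m))"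
    by (simp add: moment_def expectation_finite[OF assms(1)])
  also have "\<dots> = (\<Sum>k\<in>{m..n}. pmf \<kappa> k * real (k choose m))"
    by (intro sum.mono_neutral_right) (auto simp: binomial_eq_0)
  also have "\<dots> = pmf \<kappa> m + (\<Sum>k\<in>{m<..n}. pmf \<kappa> k * real (k choose m))"
    using assms(2) by (subst sum.head) auto
  finally show ?thesis by simp
qed

lemma moments_determine_pmf:
  assumes "set_pmf \<kappa> \<subseteq> {0..n}" "set_pmf \<kappa>' \<subseteq> {0..n}"
    and eq: "\<And>m. m \<le> n \<Longrightarrow> moment \<kappa> m = moment \<kappa>' m"
  shows "\<kappa> = \<kappa>'"
proof (rule pmf_eqI)
  fix k
  show "pmf \<kappa> k = pmf \<kappa>' k"
  proof (cases "k \<le> n")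
    case True
    then show ?thesis
    proof (induction "n - k" arbitrary: k rule: less_induct)
      case less
      have "pmf \<kappa> j = pmf \<kappa>' j" if "j \<in> {k<..n}" for j
        using that less by auto
      then have "(\<Sum>j\<in>{k<..n}. pmf \<kappa> j * real (j choose k)) = (\<Sum>j\<in>{k<..n}. pmf \<kappa>' j * real (j choose k))"
        by (intro sum.cong refl) simp
      then show ?case
        by (simp only: pmf_eq_moment_minus[OF assms(1) less.prems] pmf_eq_moment_minus[OF assms(2) less.prems]
            eq[OF less.prems])
    qed
  next
    case False
    then show ?thesis
      using assms(1,2) by (metis atLeastAtMost_iff pmf_eq_0_set_pmf subsetD)
  qed
qed

section \<open>Existence of the stationary law by monotone moments\<close>

primrec count_law :: "nat \<Rightarrow> nat pmf" where
  "count_law 0 = return_pmf 0"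
| "count_law (Suc t) = bind_pmf (count_law t) (count_step n p)"

lemma set_count_law: "set_pmf (count_law t) \<subseteq> {0..n}"
  by (induction t) (auto simp only: count_law.simps set_bind_count_step, simp)

lemma count_law_moment_Suc:
  "moment (count_law (Suc t)) (Suc m)
     = q ^ Suc m * (1 - real (Suc m) / n) * moment (count_law t) (Suc m)
       + q ^ Suc m * ((real n - real m) / n) * moment (count_law t) m"
  by (simp only: count_law.simps moment_step[OF set_count_law])

lemma moment_nonneg: "0 \<le> moment \<kappa> m"
  by (simp add: moment_def)

text \<open>From the empty start all moments of positive order are 0, hence cannot decrease in the
  first round. The recursion has nonnegative coefficients, so this ordering propagates to all later
  rounds.\<close>

lemma moment_incseq:
  assumes "m \<le> n"
  shows "moment (count_law t) m \<le> moment (count_law (Suc t)) m"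
  using assms
proof (induction t arbitrary: m)
  case 0
  then show ?case
    using moment_nonneg[of "count_law (Suc 0)" m]
    by (cases m) (auto simp: moment_0 moment_def[of "return_pmf 0"])
next
  case (Suc t)
  show ?case
  proof (cases m)
    case (Suc l)
    then have "l < n" using Suc.prems by simp
    have "q ^ Suc l * (1 - real (Suc l) / n) \<ge> 0" "q ^ Suc l * ((real n - real l) / n) \<ge> 0"
      using damping_less_1(1)[OF \<open>l < n\<close>] q_pos \<open>l < n\<close> by (auto simp del: power_Suc)
    then have "q ^ Suc l * (1 - real (Suc l) / n) * moment (count_law t) (Suc l)
          + q ^ Suc l * ((real n - real l) / n) * moment (count_law t) l
        \<le> q ^ Suc l * (1 - real (Suc l) / n) * moment (count_law (Suc t)) (Suc l)
          + q ^ Suc l * ((real n - real l) / n) * moment (count_law (Suc t)) l"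
      using Suc.IH[of "Suc l"] Suc.IH[of l] \<open>l < n\<close> by (intro add_mono mult_left_mono) simp_all
    then show ?thesis
      by (simp only: Suc count_law_moment_Suc[of t l] count_law_moment_Suc[of "Suc t" l])
  qed (simp add: moment_0)
qed

lemma convergent_moment:
  assumes "m \<le> n"
  shows "convergent (\<lambda>t. moment (count_law t) m)"
proof -
  have "moment (count_law t) m \<le> real (n choose m)" for t
  proof -
    have "moment (count_law t) m \<le> (\<Sum>k\<in>{0..n}. pmf (count_law t) k * real (n choose m))"
      unfolding moment_def expectation_finite[OF set_count_law]
      by (intro sum_mono mult_left_mono) (auto intro: binomial_right_mono)
    also have "\<dots> = real (n choose m)"
      using sum_pmf_eq_1[OF _ set_count_law[of t]] by (simp flip: sum_distrib_right)
    finally show ?thesis .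
  qed
  moreover have "incseq (\<lambda>t. moment (count_law t) m)"
    using moment_incseq[OF assms] by (rule incseq_SucI)
  ultimately show ?thesis
    using incseq_convergent by (metis convergent_def)
qed

lemma convergent_pmf_count_law: "convergent (\<lambda>t. pmf (count_law t) k)"
proof (cases "k \<le> n")
  case True
  then show ?thesis
  proof (induction "n - k" arbitrary: k rule: less_induct)
    case less
    have conv: "convergent (\<lambda>t. pmf (count_law t) j)" if "j \<in> {k<..n}" for j
      using that less by auto
    then have "convergent (\<lambda>t. moment (count_law t) k
        - (\<Sum>j\<in>{k<..n}. pmf (count_law t) j * real (j choose k)))"
      by (intro convergent_diff convergent_moment convergent_sum convergent_mult convergent_const conv less.prems)
    then show ?case
      using less.prems by (simp add: pmf_eq_moment_minus[OF set_count_law])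
  qed
next
  case False
  then have "pmf (count_law t) k = 0" for t
    using set_count_law by (metis atLeastAtMost_iff pmf_eq_0_set_pmf subsetD)
  then show ?thesis by (simp add: convergent_const)
qed

text \<open>The law of the count started from 0 converges pointwise. All laws live on {0..n}, so no
  mass escapes and the limit is again a probability law; passing to the limit in the one-step
  relation makes it invariant.\<close>

lemma ex_stationary: "\<exists>\<kappa>. count_stationary n p \<kappa>"
proof -
  define L where "L k = lim (\<lambda>t. pmf (count_law t) k)" for k
  have L: "(\<lambda>t. pmf (count_law t) k) \<longlonglongrightarrow> L k" for k
    using convergent_pmf_count_law by (simp add: L_def convergent_LIMSEQ_iff)
  have L_nonneg: "0 \<le> L k" for k
    by (rule LIMSEQ_le_const[OF L]) auto
  have L_0: "L k = 0" if "k \<notin> {0..n}" for k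
  proof -
    have "pmf (count_law t) k = 0" for t
      using set_count_law[of t] that by (metis pmf_eq_0_set_pmf subsetD)
    then show ?thesis using L[of k] by (simp add: LIMSEQ_const_iff)
  qed
  have "(\<lambda>t. \<Sum>k\<in>{0..n}. pmf (count_law t) k) \<longlonglongrightarrow> (\<Sum>k\<in>{0..n}. L k)"
    by (intro tendsto_sum L)
  moreover have "(\<Sum>k\<in>{0..n}. pmf (count_law t) k) = 1" for t
    by (rule sum_pmf_eq_1[OF _ set_count_law]) simp
  ultimately have sum_L: "(\<Sum>k\<in>{0..n}. L k) = 1"
    by (simp add: LIMSEQ_const_iff)
  have "(\<integral>\<^sup>+k. ennreal (L k) \<partial>count_space UNIV) = (\<integral>\<^sup>+k. ennreal (L k) \<partial>count_space {0..n})"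
    using L_0 by (intro nn_integral_count_space_eq) auto
  also have "\<dots> = 1"
    using sum_L L_nonneg by (simp add: nn_integral_count_space_finite sum_ennreal)
  finally have pmf_L: "pmf (embed_pmf L) k = L k" for k
    using L_nonneg by (intro pmf_embed_pmf) auto
  let ?\<kappa> = "embed_pmf L"
  have set: "set_pmf ?\<kappa> \<subseteq> {0..n}"
    using L_0 by (metis pmf_L pmf_eq_0_set_pmf subsetI)
  have bind: "pmf (bind_pmf \<kappa> (count_step n p)) k = (\<Sum>j\<in>{0..n}. pmf \<kappa> j * pmf (count_step n p j) k)"
    if "set_pmf \<kappa> \<subseteq> {0..n}" for \<kappa> k
    by (simp only: pmf_bind expectation_finite[OF that])
  have "bind_pmf ?\<kappa> (count_step n p) = ?\<kappa>"
  proof (rule pmf_eqI)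
    fix k
    have "(\<lambda>t. pmf (count_law (Suc t)) k) \<longlonglongrightarrow> (\<Sum>j\<in>{0..n}. L j * pmf (count_step n p j) k)"
      unfolding count_law.simps bind[OF set_count_law]
      by (intro tendsto_sum tendsto_mult L tendsto_const)
    moreover have "(\<lambda>t. pmf (count_law (Suc t)) k) \<longlonglongrightarrow> L k"
      using L by (rule LIMSEQ_Suc)
    ultimately show "pmf (bind_pmf ?\<kappa> (count_step n p)) k = pmf ?\<kappa> k"
      unfolding bind[OF set] pmf_L by (rule LIMSEQ_unique)
  qed
  then show ?thesis
    using set by (auto simp: count_stationary_def)
qed

section \<open>Exact formulas for the stationary law and the entrance flow\<close>

lemma nu_stationary: "count_stationary n p (nu n p)"
proof -
  obtain \<kappa> where \<kappa>: "count_stationary n p \<kappa>" using ex_stationary by blast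
  \<comment> \<open>Stationarity prescribes all moments up to n and these determine the law, so the
    definite description in \<open>nu\<close> denotes the law just found.\<close>
  have "\<kappa>' = \<kappa>" if "count_stationary n p \<kappa>'" for \<kappa>'
    using that \<kappa> by (intro moments_determine_pmf) (auto simp: stationary_moment count_stationary_def)
  with \<kappa> show ?thesis
    unfolding nu_def by (rule theI)
qed

lemma set_nu: "set_pmf (nu n p) \<subseteq> {0..n}"
  using nu_stationary by (simp add: count_stationary_def)

lemma pmf_nu_top: "pmf (nu n p) n = stat_moment n"
  using moment_top[OF set_nu] stationary_moment[OF nu_stationary] by simp

text \<open>The entrance flow is the probability of being full after the round minus that of being
  full before and after it. By stationarity the former is the stationary mass at n, and the latter
  is this mass times q^n.\<close>

lemma mu_eq: "mu n p = stat_moment n * (1 - q ^ n)"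
proof -
  let ?\<nu> = "nu n p" and ?E = "{(a, b). a < n \<and> b = n} :: (nat \<times> nat) set"
  obtain m where m: "n = Suc m" using n_pos by (cases n) auto
  \<comment> \<open>At level m + 1 = n the self-coefficient 1 - (m+1)/n is 0, and the other term is
    q^n * (1/n) * C(n, n-1) = q^n.\<close>
  have stay: "pmf (count_step n p n) n = q ^ n"
    using moment_count_step[of n m] moment_top[OF set_count_step[of n]] n_pos
    by (simp add: m del: power_Suc)
  have "mu n p = measure_pmf.expectation (bind_pmf ?\<nu> (\<lambda>k. map_pmf (Pair k) (count_step n p k))) (indicator ?E)"
    by (simp add: mu_def)
  also have "\<dots> = (\<Sum>k\<in>{0..n}. pmf ?\<nu> k * measure_pmf.prob (map_pmf (Pair k) (count_step n p k)) ?E)"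
    using set_nu by (subst pmf_expectation_bind[of "{0..n}"])
      (auto intro: finite_subset[OF set_count_step])
  also have "\<dots> = (\<Sum>k\<in>{0..n}. pmf ?\<nu> k * pmf (count_step n p k) n - (if k = n then pmf ?\<nu> n * q ^ n else 0))"
  proof (intro sum.cong refl)
    fix k assume "k \<in> {0..n}"
    then have "Pair k -` ?E = (if k = n then {} else {n})" by auto
    then show "pmf ?\<nu> k * measure_pmf.prob (map_pmf (Pair k) (count_step n p k)) ?E
       = pmf ?\<nu> k * pmf (count_step n p k) n - (if k = n then pmf ?\<nu> n * q ^ n else 0)"
      by (simp add: stay measure_pmf_single)
  qed
  also have "\<dots> = pmf (bind_pmf ?\<nu> (count_step n p)) n - pmf ?\<nu> n * q ^ n"
    by (simp add: sum_subtractf pmf_bind expectation_finite[OF set_nu])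
  also have "\<dots> = stat_moment n * (1 - q ^ n)"
    using nu_stationary by (simp add: count_stationary_def pmf_nu_top algebra_simps)
  finally show ?thesis .
qed

lemma stat_moment_prod:
  "stat_moment m = (\<Prod>i<m. q ^ Suc i) * (\<Prod>i<m. (real n - real i) / n)
     / (\<Prod>i<m. 1 - q ^ Suc i * (1 - real (Suc i) / n))"
  by (induction m) (simp_all add: mult_ac)

lemma stat_moment_top:
  "stat_moment n = fact n / real n ^ n * q ^ (n * (n + 1) div 2)
     / (\<Prod>i<n. 1 - q ^ Suc i * (1 - real (Suc i) / n))"
proof -
  have fact: "(\<Prod>i<n. real n - real i) = fact n"
    unfolding fact_prod_rev of_nat_prod lessThan_atLeast0
    by (intro prod.cong refl) (auto simp: of_nat_diff)
  have "(\<Sum>i<n. Suc i) = n * (n + 1) div 2"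
    using gauss_sum_nat[of n] by (simp add: sum.atLeast1_atMost_eq[symmetric] atLeast0AtMost sum.atMost_shift lessThan_Suc_atMost)
  then have "(\<Prod>i<n. q ^ Suc i) = q ^ (n * (n + 1) div 2)"
    by (simp only: power_sum[symmetric])
  then show ?thesis
    unfolding stat_moment_prod by (simp only: fact prod_dividef prod_constant card_lessThan mult.commute)
qed

end

section \<open>Renewal equation for the completion time\<close>

lemma sum_convolution:
  fixes h F :: "nat \<Rightarrow> real"
  shows "(\<Sum>t\<le>N. \<Sum>s\<le>t. h s * F (t - s)) = (\<Sum>s\<le>N. h s * (\<Sum>j\<le>N - s. F j))"
proof (induction N)
  case (Suc N)
  have "(\<Sum>j\<le>Suc N - s. F j) = (\<Sum>j\<le>N - s. F j) + F (Suc N - s)" if "s \<le> N" for s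
    using that by (simp add: Suc_diff_le)
  then have "(\<Sum>s\<le>N. h s * (\<Sum>j\<le>Suc N - s. F j))
      = (\<Sum>s\<le>N. h s * (\<Sum>j\<le>N - s. F j)) + (\<Sum>s\<le>N. h s * F (Suc N - s))"
    by (simp add: distrib_left sum.distrib)
  then show ?case using Suc by simp
qed simp

text \<open>The geometric tail solves the equation exactly, so its difference d from G, with partial
  sums D, satisfies |d + v D| \<le> e. Bounding v D by e, uniformly in N and v, costs a second
  e.\<close>

lemma discrete_renewal_solution:
  fixes G :: "nat \<Rightarrow> real"
  assumes v: "0 < v" and bound: "\<And>N. \<bar>G N + v * (\<Sum>k\<le>N. G k) - 1\<bar> \<le> e"
  shows "\<bar>G N - 1 / (1 + v) ^ Suc N\<bar> \<le> 2 * e"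
proof -
  define d where "d N = G N - 1 / (1 + v) ^ Suc N" for N
  define D where "D N = (\<Sum>k\<le>N. d k)" for N
  have "1 / (1 + v) ^ Suc N + v * (\<Sum>k\<le>N. 1 / (1 + v) ^ Suc k) = 1" for N
  proof (induction N)
    case 0
    then show ?case using v by (simp add: field_simps)
  next
    case (Suc N)
    have "1 / (1 + v) ^ Suc (Suc N) + v * (1 / (1 + v) ^ Suc (Suc N)) = (1 + v) / ((1 + v) * (1 + v) ^ Suc N)"
      by (simp add: add_divide_distrib)
    also have "\<dots> = 1 / (1 + v) ^ Suc N" using v by simp
    finally show ?case
      using Suc by (simp only: sum.atMost_Suc distrib_left)
  qed
  then have dD: "\<bar>d N + v * D N\<bar> \<le> e" for N
    using bound[of N] by (simp add: d_def D_def sum_subtractf algebra_simps del: power_Suc)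
  have e: "0 \<le> e" using dD[of 0] by linarith
  \<comment> \<open>D(N+1) is at most (e + |D N|)/(1+v) in absolute value, and e/v is the fixed
    point of x -> (e+x)/(1+v), hence an invariant bound.\<close>
  have "\<bar>D N\<bar> \<le> e / v" for N
  proof (induction N)
    case 0
    have "\<bar>(1 + v) * D 0\<bar> \<le> e" using dD[of 0] by (simp add: D_def algebra_simps)
    then have "\<bar>D 0\<bar> * (1 + v) \<le> e" using v by (simp add: abs_mult mult.commute)
    moreover have "\<bar>D 0\<bar> * v \<le> \<bar>D 0\<bar> * (1 + v)" by (simp add: mult_left_mono)
    ultimately show ?case using v by (simp add: pos_le_divide_eq)
  next
    case (Suc N)
    have "(1 + v) * D (Suc N) = (d (Suc N) + v * D (Suc N)) + D N"
      by (simp add: D_def algebra_simps)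
    then have "\<bar>(1 + v) * D (Suc N)\<bar> \<le> e + e / v"
      using dD[of "Suc N"] Suc by linarith
    moreover have "\<bar>(1 + v) * D (Suc N)\<bar> = (1 + v) * \<bar>D (Suc N)\<bar>" "e + e / v = (1 + v) * (e / v)"
      using v by (simp add: abs_mult, simp add: field_simps)
    ultimately have "(1 + v) * \<bar>D (Suc N)\<bar> \<le> (1 + v) * (e / v)"
      by simp
    then show ?case using v by (simp only: mult_le_cancel_left_pos add_pos_pos zero_less_one)
  qed
  from this[of N] have "\<bar>v * D N\<bar> \<le> e"
    using v by (simp add: abs_mult field_simps)
  then show ?thesis using dD[of N] unfolding d_def by linarith
qed

section \<open>Occupation probabilities of the full collection\<close>

context ccc
begin

text \<open>The expected number of m-subsets held after t rounds started from the given set. For m =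
  n this is the probability that the collection is full at time t.\<close>

definition ex_choose :: "nat \<Rightarrow> nat \<Rightarrow> nat set \<Rightarrow> real" where
  "ex_choose t m = (avg ^^ t) (\<lambda>A. real (card A choose m))"

lemma ex_choose_0: "ex_choose 0 m A = real (card A choose m)"
  by (simp add: ex_choose_def)

lemma ex_choose_Suc: "ex_choose (Suc t) m A = avg (ex_choose t m) A"
  by (simp add: ex_choose_def)

lemma ex_choose_m_0: "ex_choose t 0 A = 1"
proof (induction t arbitrary: A)
  case (Suc t)
  then have "ex_choose t 0 = (\<lambda>_. 1)" by (intro ext)
  then show ?case by (simp add: ex_choose_Suc)
qed (simp add: ex_choose_0)

text \<open>Each \<open>avg\<close> peels off the first round, whereas the recursion concerns the
  last one. The relation holds for t = 0 by \<open>avg_choose\<close>, and linearity of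
  \<open>avg\<close> carries it through earlier rounds.\<close>

lemma ex_choose_step:
  assumes "A \<subseteq> full"
  shows "ex_choose (Suc t) (Suc m) A
     = q ^ Suc m * (1 - real (Suc m) / n) * ex_choose t (Suc m) A
       + q ^ Suc m * ((real n - real m) / n) * ex_choose t m A"
  using assms
proof (induction t arbitrary: A)
  case 0
  then show ?case
    by (simp only: ex_choose_Suc ex_choose_0[abs_def] avg_choose distrib_left mult.assoc)
next
  case (Suc t)
  have "ex_choose (Suc (Suc t)) (Suc m) A = avg (ex_choose (Suc t) (Suc m)) A"
    by (rule ex_choose_Suc)
  also have "\<dots> = avg (\<lambda>A. q ^ Suc m * (1 - real (Suc m) / n) * ex_choose t (Suc m) A
       + q ^ Suc m * ((real n - real m) / n) * ex_choose t m A) A"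
    by (intro avg_cong Suc)
  finally show ?case
    by (simp only: avg_lin ex_choose_Suc)
qed

text \<open>Dividing by the binomial coefficient turns the expected number of fully held m-sets
  into the probability that one given m-set is held.\<close>
definition held :: "nat set \<Rightarrow> nat \<Rightarrow> nat \<Rightarrow> real" where
  "held A t m = ex_choose t m A / real (n choose m)"

definition stat_held :: "nat \<Rightarrow> real" where
  "stat_held m = stat_moment m / real (n choose m)"

lemma choose_ratio:
  assumes "m < n"
  shows "(real n - real m) / n / real (n choose Suc m) = real (Suc m) / n / real (n choose m)"
proof -
  have "Suc m * (n choose Suc m) = (n - m) * (n choose m)"
    by (simp only: binomial_absorption binomial_absorb_comp)
  then have "real (Suc m) * real (n choose Suc m) = (real n - real m) * real (n choose m)"
    using assms by (metis less_imp_le of_nat_diff of_nat_mult)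
  moreover have "0 < real (n choose Suc m)" "0 < real (n choose m)"
    using assms by auto
  ultimately have "(real n - real m) / real (n choose Suc m) = real (Suc m) / real (n choose m)"
    by (subst frac_eq_eq) auto
  then show ?thesis
    by (metis divide_divide_eq_left divide_divide_eq_right mult.commute)
qed

text \<open>The draw either misses the (m+1)-set, which must then be held already, or hits it, and
  then the other m elements must be held. The weights form a convex combination, so a round
  contracts by q^(m+1).\<close>

lemma held_step:
  assumes "A \<subseteq> full" "m < n"
  shows "held A (Suc t) (Suc m)
     = q ^ Suc m * ((1 - real (Suc m) / n) * held A t (Suc m) + real (Suc m) / n * held A t m)"
proof -
  have "held A (Suc t) (Suc m) = q ^ Suc m * ((1 - real (Suc m) / n) * held A t (Suc m)
      + (real n - real m) / n / real (n choose Suc m) * ex_choose t m A)"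
    unfolding held_def ex_choose_step[OF assms(1)]
    by (simp only: add_divide_distrib distrib_left times_divide_eq_left times_divide_eq_right mult.assoc)
  then show ?thesis
    unfolding choose_ratio[OF assms(2)] by (simp add: held_def)
qed

lemma stat_held_step:
  assumes "m < n"
  shows "stat_held (Suc m)
     = q ^ Suc m * ((1 - real (Suc m) / n) * stat_held (Suc m) + real (Suc m) / n * stat_held m)"
proof -
  define \<alpha> where "\<alpha> = q ^ Suc m * (1 - real (Suc m) / n)"
  have \<alpha>: "\<alpha> < 1" using damping_less_1(2)[OF assms] by (simp only: \<alpha>_def)
  have "stat_moment (Suc m) = q ^ Suc m * ((real n - real m) / n) * stat_moment m / (1 - \<alpha>)"
    by (simp only: stat_moment.simps \<alpha>_def)
  moreover have "x = y / (1 - \<alpha>) \<Longrightarrow> x = \<alpha> * x + y" for x y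
    using \<alpha> by (simp add: field_simps)
  ultimately have "stat_moment (Suc m) = \<alpha> * stat_moment (Suc m) + q ^ Suc m * ((real n - real m) / n) * stat_moment m"
    by blast
  then have "stat_held (Suc m) = \<alpha> * stat_held (Suc m)
     + q ^ Suc m * ((real n - real m) / n / real (n choose Suc m)) * stat_moment m"
    unfolding stat_held_def
    by (metis (no_types, opaque_lifting) add_divide_distrib times_divide_eq_left times_divide_eq_right)
  then show ?thesis
    unfolding choose_ratio[OF assms] \<alpha>_def stat_held_def[of m]
    by (simp only: distrib_left mult.assoc times_divide_eq_left times_divide_eq_right)
qed

lemma q_power_le_1: "0 < q ^ m" "q ^ m \<le> 1"
  using q_pos q_less_1 by (auto intro: power_le_one)

text \<open>With x = (m+1)/n and Q = q^(m+1), the new value is Q x / (1 - Q (1-x)) times the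
  previous one, and this ratio is at most 1 because Q \<le> 1.\<close>

lemma stat_held_bounds:
  assumes "m \<le> n"
  shows "0 \<le> stat_held m \<and> stat_held m \<le> 1"
  using assms
proof (induction m)
  case 0
  then show ?case by (simp add: stat_held_def)
next
  case (Suc m)
  define x where "x = real (Suc m) / n"
  define Q where "Q = q ^ Suc m"
  define b where "b = stat_held m"
  define c where "c = stat_held (Suc m)"
  have x: "0 < x" "x \<le> 1" using Suc.prems by (auto simp: x_def divide_simps)
  have Q: "0 < Q" "Q \<le> 1" unfolding Q_def by (rule q_power_le_1)+
  have b: "0 \<le> b" "b \<le> 1" using Suc by (auto simp: b_def)
  have "c = Q * ((1 - x) * c + x * b)"
    using stat_held_step[of m] Suc.prems by (simp only: c_def Q_def x_def b_def Suc_le_eq)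
  then have c: "c * (1 - Q * (1 - x)) = Q * (x * b)"
    by (simp add: algebra_simps)
  have pos: "0 < 1 - Q * (1 - x)"
    using damping_less_1(2)[of m] Suc.prems by (simp only: Q_def x_def Suc_le_eq) simp
  have "0 \<le> Q * (x * b)" using Q x b by simp
  with c pos have "0 \<le> c" by (metis mult.commute zero_le_mult_iff not_less)
  moreover have "Q * (x * b) \<le> Q * (x * 1)"
    using Q x b by (intro mult_left_mono) auto
  moreover have "Q * (x * 1) \<le> 1 * (1 - Q * (1 - x))"
    using Q by (simp add: algebra_simps)
  ultimately have "c * (1 - Q * (1 - x)) \<le> 1 * (1 - Q * (1 - x))" "0 \<le> c"
    using c by simp_all
  then have "c \<le> 1"
    using pos by (simp only: mult_le_cancel_right_pos)
  with \<open>0 \<le> c\<close> show ?case by (simp add: c_def)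
qed

lemma stat_held_top: "stat_held n = stat_moment n"
  by (simp add: stat_held_def)

text \<open>At level n the draw cannot miss the set, so the self-term of
  \<open>stat_held_step\<close> vanishes and a bare factor q^n remains.\<close>

lemma stat_moment_le: "stat_moment n \<le> q ^ n"
proof -
  obtain m where m: "n = Suc m" using n_pos by (cases n) auto
  have "stat_held n = q ^ n * stat_held m"
    using stat_held_step[of m] m n_pos by (simp del: power_Suc)
  also have "\<dots> \<le> q ^ n * 1"
    using stat_held_bounds[of m] m by (intro mult_left_mono less_imp_le[OF q_power_le_1(1)]) auto
  finally show ?thesis by (simp add: stat_held_top)
qed

lemma stat_moment_pos: "0 < stat_moment n"
proof -
  have "0 < stat_moment m" if "m \<le> n" for m
    using that
  proof (induction m)
    case (Suc m)
    have "0 < 1 - q ^ Suc m * (1 - real (Suc m) / n)"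
      using damping_less_1(2)[of m] Suc.prems by (simp only: Suc_le_eq) simp
    moreover have "0 < q ^ Suc m * ((real n - real m) / n) * stat_moment m"
      using Suc q_pos by (intro mult_pos_pos divide_pos_pos) auto
    ultimately show ?case by (simp only: stat_moment.simps divide_pos_pos)
  qed simp
  then show ?thesis by simp
qed

text \<open>The number 1/p is the fixed point of x -> 1 + q x, so it bounds the partial time sums at
  all levels, by induction on the number of terms simultaneously in m. One more use of the recursion
  at level n, without the initial term, gains q^n.\<close>

lemma sum_deviation_le:
  fixes D :: "nat \<Rightarrow> nat \<Rightarrow> real"
  assumes step: "\<And>t m. m < n \<Longrightarrow>
      D (Suc t) (Suc m) \<le> q ^ Suc m * ((1 - real (Suc m) / n) * D t (Suc m) + real (Suc m) / n * D t m)"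
    and D_0: "\<And>t. D t 0 = 0" and init: "\<And>m. m \<le> n \<Longrightarrow> D 0 m \<le> 1"
  shows "m \<le> n \<Longrightarrow> (\<Sum>t<N. D t m) \<le> 1 / p"
    and "(\<Sum>t<N. D (Suc t) n) \<le> q ^ n / p"
proof -
  have shifted: "(\<Sum>t<N. D (Suc t) (Suc m)) \<le> q ^ Suc m / p"
    if "m < n" and IH: "\<And>m. m \<le> n \<Longrightarrow> (\<Sum>t<N. D t m) \<le> 1 / p" for m N
  proof -
    have x: "0 \<le> 1 - real (Suc m) / n" "0 \<le> real (Suc m) / n" using \<open>m < n\<close> by auto
    have "(\<Sum>t<N. D (Suc t) (Suc m))
        \<le> (\<Sum>t<N. q ^ Suc m * ((1 - real (Suc m) / n) * D t (Suc m) + real (Suc m) / n * D t m))"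
      by (intro sum_mono step \<open>m < n\<close>)
    also have "\<dots> = q ^ Suc m * ((1 - real (Suc m) / n) * (\<Sum>t<N. D t (Suc m)) + real (Suc m) / n * (\<Sum>t<N. D t m))"
      by (simp only: sum_distrib_left[symmetric] sum.distrib)
    also have "\<dots> \<le> q ^ Suc m * ((1 - real (Suc m) / n) * (1 / p) + real (Suc m) / n * (1 / p))"
      using \<open>m < n\<close> x q_power_le_1(1)[of "Suc m"]
      by (intro mult_left_mono add_mono IH) (auto simp del: power_Suc)
    also have "\<dots> = q ^ Suc m / p"
      by (simp only: distrib_right[symmetric]) simp
    finally show ?thesis .
  qed
  show le: "(\<Sum>t<N. D t m) \<le> 1 / p" if "m \<le> n" for m N
    using that
  proof (induction N arbitrary: m)
    case 0
    then show ?case using p_pos by simp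
  next
    case (Suc N)
    show ?case
    proof (cases m)
      case 0
      then show ?thesis using p_pos by (simp add: D_0)
    next
      case (Suc l)
      have "(\<Sum>t<Suc N. D t m) = D 0 m + (\<Sum>t<N. D (Suc t) m)"
        by (rule sum.lessThan_Suc_shift)
      also have "\<dots> \<le> 1 + q ^ m / p"
        using shifted[of l N] Suc.IH \<open>m \<le> n\<close> init[of m] Suc by (intro add_mono) (auto simp del: power_Suc)
      also have "q ^ m \<le> q"
        using q_pos q_less_1 Suc power_decreasing[of 1 m q] by simp
      then have "1 + q ^ m / p \<le> 1 + q / p"
        using p_pos by (simp add: divide_right_mono)
      also have "\<dots> = 1 / p"
        using p_pos by (simp add: q_def field_simps)
      finally show ?thesis .
    qed
  qed
  obtain m where m: "n = Suc m" using n_pos by (cases n) auto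
  show "(\<Sum>t<N. D (Suc t) n) \<le> q ^ n / p"
    using shifted[OF _ le, of m N] unfolding m by simp
qed

text \<open>The deviations of \<open>held\<close> from \<open>stat_held\<close> obey the contraction
  in absolute value. For the two starts considered the initial \<open>held\<close> values are 0 or
  1, so the initial deviations are at most 1.\<close>

lemma sum_occupation:
  assumes "A = {} \<or> A = full"
  shows "\<bar>(\<Sum>t\<le>N. ex_choose t n A) - of_bool (A = full) - real (Suc N) * stat_moment n\<bar> \<le> q ^ n * (1 + 1 / p)"
proof -
  have A: "A \<subseteq> full" using assms by auto
  have card: "real (card A choose n) = of_bool (A = full)"
    using assms n_pos by auto
  define D where "D t m = \<bar>held A t m - stat_held m\<bar>" for t m
  have "D (Suc t) (Suc m) \<le> q ^ Suc m * ((1 - real (Suc m) / n) * D t (Suc m) + real (Suc m) / n * D t m)"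
    if "m < n" for t m
  proof -
    define x where "x = real (Suc m) / n"
    have x: "0 \<le> 1 - x" "0 \<le> x" using \<open>m < n\<close> by (auto simp: x_def)
    have "held A (Suc t) (Suc m) - stat_held (Suc m)
        = q ^ Suc m * ((1 - x) * (held A t (Suc m) - stat_held (Suc m)) + x * (held A t m - stat_held m))"
      unfolding x_def
      by (subst held_step[OF A that], subst stat_held_step[OF that]) (simp add: algebra_simps)
    also have "\<bar>\<dots>\<bar> \<le> q ^ Suc m * ((1 - x) * D t (Suc m) + x * D t m)"
      unfolding abs_mult using q_power_le_1(1)[of "Suc m"] x
      by (intro mult_mono order.trans[OF abs_triangle_ineq]) (auto simp: abs_mult D_def simp del: power_Suc)
    finally show ?thesis by (simp only: D_def x_def)
  qed
  moreover have "D t 0 = 0" for t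
    by (simp add: D_def held_def stat_held_def ex_choose_m_0)
  moreover have "D 0 m \<le> 1" if "m \<le> n" for m
  proof -
    have "held A 0 m \<in> {0, 1}"
      using assms that by (cases m) (auto simp: held_def ex_choose_0)
    then show ?thesis using stat_held_bounds[OF that] by (auto simp: D_def)
  qed
  ultimately have "(\<Sum>t<N. D (Suc t) n) \<le> q ^ n / p"
    by (rule sum_deviation_le(2))
  then have "\<bar>\<Sum>t<N. ex_choose (Suc t) n A - stat_moment n\<bar> \<le> q ^ n / p"
    by (intro order.trans[OF sum_abs]) (simp add: D_def held_def stat_held_top)
  \<comment> \<open>The term t = 0 equals the indicator exactly, leaving one uncompensated
    \<open>stat_moment n\<close>; it is at most q^n and accounts for the 1 in 1 + 1/p.\<close>
  moreover have "(\<Sum>t\<le>N. ex_choose t n A) - of_bool (A = full) - real (Suc N) * stat_moment n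
      = (\<Sum>t<N. ex_choose (Suc t) n A - stat_moment n) - stat_moment n"
    unfolding lessThan_Suc_atMost[symmetric]
    by (subst sum.lessThan_Suc_shift) (simp add: ex_choose_0 card sum_subtractf algebra_simps)
  moreover have "q ^ n * (1 + 1 / p) = q ^ n / p + q ^ n" by (simp add: algebra_simps)
  ultimately show ?thesis
    using stat_moment_pos stat_moment_le by linarith
qed

section \<open>First passage to the full collection\<close>

primrec first_hit :: "nat \<Rightarrow> nat set \<Rightarrow> real" where
  "first_hit 0 A = of_bool (A = full)"
| "first_hit (Suc s) A = (if A = full then 0 else avg (first_hit s) A)"

text \<open>First-passage decomposition: \<open>first_hit s A\<close> is the probability that the
  chain from A is full for the first time at s, and from then on it restarts from the full set. The
  induction conditions on the first round.\<close>

lemma renewal: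
  assumes "A \<subseteq> full"
  shows "ex_choose t n A = (\<Sum>s\<le>t. first_hit s A * ex_choose (t - s) n full)"
  using assms
proof (induction t arbitrary: A)
  case 0
  show ?case
  proof (cases "A = full")
    case False
    then have "card A < n" "first_hit 0 A = 0"
      using psubset_card_mono[of full A] 0 by auto
    then show ?thesis by (simp add: ex_choose_0 binomial_eq_0 del: first_hit.simps)
  qed (simp add: ex_choose_0)
next
  case (Suc t)
  show ?case
  proof (cases "A = full")
    case True
    then show ?thesis by (simp add: sum.atMost_Suc_shift del: sum.atMost_Suc)
  next
    case False
    have "ex_choose (Suc t) n A = avg (\<lambda>A. \<Sum>s\<le>t. first_hit s A * ex_choose (t - s) n full) A"
      unfolding ex_choose_Suc by (intro avg_cong Suc)
    also have "\<dots> = (\<Sum>s\<le>t. avg (first_hit s) A * ex_choose (t - s) n full)"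
      by (simp only: avg_sum_swap avg_mult_right)
    finally show ?thesis
      using False by (simp add: sum.atMost_Suc_shift del: sum.atMost_Suc)
  qed
qed

definition hit_by :: "nat \<Rightarrow> nat set \<Rightarrow> real" where
  "hit_by N A = (\<Sum>s\<le>N. first_hit s A)"

lemma hit_by_0: "hit_by 0 A = of_bool (A = full)"
  by (simp add: hit_by_def)

lemma hit_by_Suc: "hit_by (Suc N) A = (if A = full then 1 else avg (hit_by N) A)"
  unfolding hit_by_def[abs_def] avg_sum_swap by (simp add: sum.atMost_Suc_shift del: sum.atMost_Suc)

lemma first_hit_nonneg: "0 \<le> first_hit s A"
  by (induction s arbitrary: A) (auto simp: avg_sum intro!: sum_nonneg mult_nonneg_nonneg)

lemma hit_by_le_1:
  assumes "A \<subseteq> full"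
  shows "hit_by N A \<le> 1"
  using assms
proof (induction N arbitrary: A)
  case (Suc N)
  then have "avg (hit_by N) A \<le> avg (\<lambda>_. 1) A" by (intro avg_mono)
  then show ?case by (simp add: hit_by_Suc)
qed (simp add: hit_by_0)

text \<open>The expected occupation time of the full set up to N from the empty start is computed
  twice: directly, and through the renewal equation summed over time with
  \<open>sum_occupation\<close> for the full start. Each computation contributes one error term,
  hence the factor 2.\<close>

lemma no_hit_renewal:
  fixes N
  defines "G \<equiv> (\<lambda>N. 1 - hit_by N {})"
  shows "\<bar>G N + stat_moment n * (\<Sum>k\<le>N. G k) - 1\<bar> \<le> 2 * (q ^ n * (1 + 1 / p))"
proof -
  let ?\<epsilon> = "q ^ n * (1 + 1 / p)" and ?v = "stat_moment n"
  define h where "h s = first_hit s {}" for s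
  define \<Phi> where "\<Phi> k = (\<Sum>j\<le>k. ex_choose j n full)" for k
  have \<Phi>: "\<bar>\<Phi> k - 1 - real (Suc k) * ?v\<bar> \<le> ?\<epsilon>" for k
    using sum_occupation[of full k] by (simp add: \<Phi>_def)
  have eps: "0 \<le> ?\<epsilon>" using \<Phi>[of 0] by linarith
  have H: "hit_by k {} = (\<Sum>s\<le>k. h s)" for k
    by (simp add: hit_by_def h_def)
  have occ: "(\<Sum>t\<le>N. ex_choose t n {}) = (\<Sum>s\<le>N. h s * \<Phi> (N - s))"
    unfolding \<Phi>_def sum_convolution[symmetric] h_def by (intro sum.cong refl renewal) simp
  \<comment> \<open>Taking F = 1 in the convolution expresses the summed hitting probabilities with
    the weights N - s + 1.\<close>
  have sumH: "(\<Sum>k\<le>N. hit_by k {}) = (\<Sum>s\<le>N. h s * real (Suc (N - s)))"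
    using sum_convolution[of h "\<lambda>_. 1" N] by (simp add: H)
  have "\<bar>\<Sum>s\<le>N. h s * (\<Phi> (N - s) - 1 - real (Suc (N - s)) * ?v)\<bar> \<le> (\<Sum>s\<le>N. h s * ?\<epsilon>)"
  proof (rule order.trans[OF sum_abs sum_mono])
    fix s
    show "\<bar>h s * (\<Phi> (N - s) - 1 - real (Suc (N - s)) * ?v)\<bar> \<le> h s * ?\<epsilon>"
      using mult_left_mono[OF \<Phi>[of "N - s"], of "h s"] first_hit_nonneg[of s "{}"]
      by (simp only: abs_mult h_def abs_of_nonneg)
  qed
  \<comment> \<open>The weights h are first-passage probabilities with total at most 1, so the
    errors do not accumulate as N grows.\<close>
  also have "\<dots> \<le> 1 * ?\<epsilon>"
    unfolding sum_distrib_right[symmetric] H[symmetric]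
    by (intro mult_right_mono hit_by_le_1 eps) simp
  also have "(\<Sum>s\<le>N. h s * (\<Phi> (N - s) - 1 - real (Suc (N - s)) * ?v))
      = (\<Sum>s\<le>N. h s * \<Phi> (N - s)) - hit_by N {} - ?v * (\<Sum>k\<le>N. hit_by k {})"
    unfolding sumH unfolding H by (simp add: sum_distrib_left sum_subtractf[symmetric] algebra_simps)
  finally have "\<bar>(\<Sum>t\<le>N. ex_choose t n {}) - hit_by N {} - ?v * (\<Sum>k\<le>N. hit_by k {})\<bar> \<le> ?\<epsilon>"
    unfolding occ by simp
  moreover have "\<bar>(\<Sum>t\<le>N. ex_choose t n {}) - real (Suc N) * ?v\<bar> \<le> ?\<epsilon>"
    using sum_occupation[of "{}" N] n_pos by simp
  moreover have "?v * (\<Sum>k\<le>N. G k) = real (Suc N) * ?v - ?v * (\<Sum>k\<le>N. hit_by k {})"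
    by (simp add: G_def sum_subtractf algebra_simps)
  ultimately show ?thesis unfolding G_def by linarith
qed

lemma hit_by_approx:
  "\<bar>hit_by N {} - (1 - 1 / (1 + stat_moment n) ^ Suc N)\<bar> \<le> 4 * (q ^ n * (1 + 1 / p))"
  using discrete_renewal_solution[OF stat_moment_pos no_hit_renewal, of N] by simp

end

section \<open>Law of the completion time and limits\<close>

lemma emeasure_PiM_first_step:
  fixes P :: "'a pmf"
  defines "M \<equiv> PiM UNIV (\<lambda>_ :: nat. measure_pmf P)"
  assumes X: "X \<in> sets M"
  shows "emeasure M X = (\<integral>\<^sup>+r. emeasure M {\<omega>. case_nat r \<omega> \<in> X} \<partial>measure_pmf P)"
proof -
  interpret sequence_space "measure_pmf P" ..
  interpret M: prob_space M unfolding M_def by (rule P.prob_space_axioms)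
  let ?D = "measure_pmf P \<Otimes>\<^sub>M M" and ?f = "\<lambda>(r, \<omega>). case_nat r \<omega>"
  have space: "space M = UNIV" by (simp add: M_def space_PiM)
  have [measurable]: "?f \<in> measurable ?D M"
    unfolding M_def by measurable
  \<comment> \<open>An i.i.d. sequence is distributed as an independent first entry put in front of
    another such sequence; integrating over sections then isolates the first round.\<close>
  have "emeasure M X = emeasure (distr ?D M ?f) X"
    using PiM_iter by (simp add: M_def)
  also have "\<dots> = emeasure ?D (?f -` X)"
    using X by (subst emeasure_distr) (auto simp: space_pair_measure space)
  also have "\<dots> = (\<integral>\<^sup>+r. emeasure M (Pair r -` (?f -` X)) \<partial>measure_pmf P)"
    using measurable_sets[of ?f ?D M X] X
    by (intro M.emeasure_pair_measure_alt) (simp add: space_pair_measure space)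
  finally show ?thesis by (simp add: vimage_def)
qed

text \<open>Generalises \<open>ccc_S\<close> to any initial set, which restarting the path after its
  first round requires.\<close>

primrec run :: "nat set \<Rightarrow> (nat \<Rightarrow> nat \<times> (nat \<Rightarrow> bool)) \<Rightarrow> nat \<Rightarrow> nat set" where
  "run A \<omega> 0 = A"
| "run A \<omega> (Suc t) = upd (\<omega> t) (run A \<omega> t)"

lemma ccc_S_eq_run: "ccc_S \<omega> t = run {} \<omega> t"
  by (induction t) (auto simp: upd_def)

lemma run_case_nat: "run A (case_nat r \<omega>) (Suc t) = run (upd r A) \<omega> t"
  by (induction t) auto

context ccc
begin

abbreviation "\<Omega> \<equiv> ccc_space n p"

lemma space_ccc: "space \<Omega> = UNIV"
  by (simp add: ccc_space_def space_PiM)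

lemma prob_space_ccc: "prob_space \<Omega>"
  unfolding ccc_space_def by (intro prob_space_PiM measure_pmf.prob_space_axioms)

lemma pred_round [measurable]: "Measurable.pred \<Omega> (\<lambda>\<omega>. Q (\<omega> t))"
proof -
  have "(\<lambda>\<omega>. \<omega> t) \<in> measurable \<Omega> (measure_pmf (round_pmf n p))"
    unfolding ccc_space_def by (rule measurable_component_singleton) simp
  then show ?thesis
    by (rule measurable_compose) simp
qed

lemma pred_mem_run [measurable]: "Measurable.pred \<Omega> (\<lambda>\<omega>. x \<in> run A \<omega> t)"
proof (induction t)
  case (Suc t)
  note Suc [measurable]
  have "x \<in> run A \<omega> (Suc t) \<longleftrightarrow> (fst (\<omega> t) = x \<or> x \<in> run A \<omega> t) \<and> \<not> snd (\<omega> t) x" for \<omega>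
    by (auto simp: upd_def)
  then show ?case by simp
qed simp

text \<open>Types are natural numbers, so equality of sets is a countable conjunction of measurable
  membership conditions.\<close>

lemma pred_run_eq [measurable]: "Measurable.pred \<Omega> (\<lambda>\<omega>. run A \<omega> t = B)"
proof -
  have "run A \<omega> t = B \<longleftrightarrow> (\<forall>x. x \<in> run A \<omega> t \<longleftrightarrow> x \<in> B)" for \<omega>
    by auto
  then show ?thesis by simp
qed

definition hit_event :: "nat \<Rightarrow> nat set \<Rightarrow> (nat \<Rightarrow> nat \<times> (nat \<Rightarrow> bool)) set" where
  "hit_event N A = {\<omega>. \<exists>s\<le>N. run A \<omega> s = full}"

lemma sets_hit_event [measurable]: "hit_event N A \<in> sets \<Omega>"
proof -
  have "{\<omega> \<in> space \<Omega>. \<exists>s\<le>N. run A \<omega> s = full} \<in> sets \<Omega>" by measurable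
  then show ?thesis by (simp add: hit_event_def space_ccc)
qed

text \<open>Links the path measure to the backward recursion: both sides obey the same first-step
  equation.\<close>

lemma emeasure_hit_event:
  assumes "A \<subseteq> full"
  shows "emeasure \<Omega> (hit_event N A) = ennreal (hit_by N A)"
  using assms
proof (induction N arbitrary: A)
  case 0
  have "hit_event 0 A = (if A = full then space \<Omega> else {})"
    by (auto simp: hit_event_def space_ccc)
  then show ?case
    using prob_space.emeasure_space_1[OF prob_space_ccc] by (simp add: hit_by_0)
next
  case (Suc N)
  show ?case
  proof (cases "A = full")
    case True
    then have "hit_event (Suc N) A = space \<Omega>"
      by (auto simp: hit_event_def space_ccc intro!: exI[of _ 0])
    then show ?thesis
      using prob_space.emeasure_space_1[OF prob_space_ccc] True by (simp add: hit_by_Suc)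
  next
    case False
    \<comment> \<open>A is not full, so time 0 yields no hit, and the remaining times are those of
      the shifted sequence run from \<open>upd r A\<close>.\<close>
    have shift: "{\<omega>. case_nat r \<omega> \<in> hit_event (Suc N) A} = hit_event N (upd r A)" for r
    proof -
      have "(\<exists>s\<le>Suc N. run A (case_nat r \<omega>) s = full) \<longleftrightarrow> (\<exists>s\<le>N. run A (case_nat r \<omega>) (Suc s) = full)" for \<omega>
        using False by (metis Suc_le_mono not0_implies_Suc run.simps(1))
      then show ?thesis
        unfolding hit_event_def run_case_nat by simp
    qed
    have "emeasure \<Omega> (hit_event (Suc N) A)
        = (\<integral>\<^sup>+r. emeasure \<Omega> (hit_event N (upd r A)) \<partial>measure_pmf (round_pmf n p))"
      using emeasure_PiM_first_step[of "hit_event (Suc N) A" "round_pmf n p"] sets_hit_event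
      by (simp add: shift ccc_space_def)
    also have "\<dots> = (\<integral>\<^sup>+r. ennreal (hit_by N (upd r A)) \<partial>measure_pmf (round_pmf n p))"
      using Suc by (intro nn_integral_cong_AE) (auto simp: AE_measure_pmf_iff dest: upd_subset)
    also have "\<dots> = ennreal (avg (hit_by N) A)"
      unfolding avg_def
      by (intro nn_integral_eq_integral integrable_measure_pmf_finite)
         (auto simp: hit_by_def first_hit_nonneg sum_nonneg)
    finally show ?thesis
      using False by (simp add: hit_by_Suc)
  qed
qed

lemma prob_hit_event: "measure \<Omega> (hit_event N {}) = hit_by N {}"
  using emeasure_hit_event[of "{}" N]
  by (simp add: measure_def hit_by_def first_hit_nonneg sum_nonneg)

lemma measurable_ccc_T [measurable]: "ccc_T n \<in> measurable \<Omega> (count_space UNIV)"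
  unfolding ccc_T_def[abs_def] ccc_S_eq_run by measurable

text \<open>On paths that never complete, the \<open>LEAST\<close> in \<open>ccc_T\<close> has an
  unspecified value. Letting N tend to infinity in \<open>hit_by_approx\<close> removes the
  geometric tail and bounds their probability by the error term, which suffices for the
  limit.\<close>

lemma prob_never_hit: "measure \<Omega> {\<omega>. \<forall>s. run {} \<omega> s \<noteq> full} \<le> 4 * (q ^ n * (1 + 1 / p))"
proof -
  interpret prob_space \<Omega> by (rule prob_space_ccc)
  let ?e = "4 * (q ^ n * (1 + 1 / p))"
  have le: "measure \<Omega> {\<omega>. \<forall>s. run {} \<omega> s \<noteq> full} \<le> ?e + 1 / (1 + stat_moment n) ^ Suc N" for N
  proof -
    have "measure \<Omega> {\<omega>. \<forall>s. run {} \<omega> s \<noteq> full} \<le> measure \<Omega> (space \<Omega> - hit_event N {})"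
      by (rule finite_measure_mono[OF _ sets.compl_sets[OF sets_hit_event]]) (auto simp: hit_event_def space_ccc)
    also have "\<dots> = 1 - hit_by N {}"
      by (simp add: prob_compl prob_hit_event)
    also have "\<dots> \<le> ?e + 1 / (1 + stat_moment n) ^ Suc N"
      using hit_by_approx[of N] by linarith
    finally show ?thesis .
  qed
  have "(\<lambda>N. inverse ((1 + stat_moment n) ^ Suc N)) \<longlonglongrightarrow> 0"
    using stat_moment_pos by (intro LIMSEQ_Suc[OF LIMSEQ_inverse_realpow_zero]) simp
  then have "(\<lambda>N. ?e + 1 / (1 + stat_moment n) ^ Suc N) \<longlonglongrightarrow> ?e + 0"
    by (intro tendsto_add tendsto_const) (simp only: inverse_eq_divide)
  then show ?thesis
    using le by (intro LIMSEQ_le_const[of _ ?e]) auto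
qed

text \<open>The event T \<le> N contains the hitting event and exceeds it only by paths that never
  complete. Two errors of size 4 add up to 8.\<close>

lemma prob_T_le_approx:
  "\<bar>measure \<Omega> {\<omega>. ccc_T n \<omega> \<le> N} - (1 - 1 / (1 + stat_moment n) ^ Suc N)\<bar> \<le> 8 * (q ^ n * (1 + 1 / p))"
proof -
  interpret prob_space \<Omega> by (rule prob_space_ccc)
  let ?never = "{\<omega>. \<forall>s. run {} \<omega> s \<noteq> full}"
  have "{\<omega> \<in> space \<Omega>. \<forall>s. run {} \<omega> s \<noteq> full} \<in> sets \<Omega>" "{\<omega> \<in> space \<Omega>. ccc_T n \<omega> \<le> N} \<in> sets \<Omega>"
    by measurable
  then have [measurable]: "?never \<in> sets \<Omega>" "{\<omega>. ccc_T n \<omega> \<le> N} \<in> sets \<Omega>"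
    by (simp_all add: space_ccc)
  have "hit_event N {} \<subseteq> {\<omega>. ccc_T n \<omega> \<le> N}"
    by (auto simp: hit_event_def ccc_T_def ccc_S_eq_run intro: Least_le order.trans)
  then have "hit_by N {} \<le> measure \<Omega> {\<omega>. ccc_T n \<omega> \<le> N}"
    unfolding prob_hit_event[symmetric] by (rule finite_measure_mono) measurable
  moreover have "{\<omega>. ccc_T n \<omega> \<le> N} \<subseteq> hit_event N {} \<union> ?never"
  proof
    fix \<omega> assume le: "\<omega> \<in> {\<omega>. ccc_T n \<omega> \<le> N}"
    show "\<omega> \<in> hit_event N {} \<union> ?never"
    proof (cases "\<omega> \<in> ?never")
      case False
      then obtain s where "run {} \<omega> s = full" by auto
      then have "run {} \<omega> (ccc_T n \<omega>) = full"
        unfolding ccc_T_def ccc_S_eq_run by (rule LeastI)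
      then show ?thesis
        using le by (auto simp: hit_event_def)
    qed simp
  qed
  then have "measure \<Omega> {\<omega>. ccc_T n \<omega> \<le> N} \<le> measure \<Omega> (hit_event N {} \<union> ?never)"
    by (rule finite_measure_mono) measurable
  moreover have "\<dots> \<le> hit_by N {} + measure \<Omega> ?never"
    unfolding prob_hit_event[symmetric] by (rule measure_Un_le) measurable
  ultimately show ?thesis
    using hit_by_approx[of N] prob_never_hit by linarith
qed

lemma mu_pos: "0 < mu n p"
  unfolding mu_eq using stat_moment_pos q_pos q_less_1 n_pos by (simp add: power_Suc_less_one power_less_one_iff)

lemma cdf_scaled_T:
  "cdf (distr \<Omega> borel (\<lambda>\<omega>. mu n p * real (ccc_T n \<omega>))) x = measure \<Omega> {\<omega>. mu n p * real (ccc_T n \<omega>) \<le> x}"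
  unfolding cdf_def by (subst measure_distr) (auto simp: space_ccc vimage_def)

lemma cdf_scaled_T_neg:
  "x < 0 \<Longrightarrow> cdf (distr \<Omega> borel (\<lambda>\<omega>. mu n p * real (ccc_T n \<omega>))) x = 0"
proof -
  assume "x < 0"
  then have "{\<omega>. mu n p * real (ccc_T n \<omega>) \<le> x} = {}"
    using mu_pos by (auto simp: not_le intro: order.strict_trans2)
  then show ?thesis by (simp add: cdf_scaled_T)
qed

lemma cdf_scaled_T_approx:
  assumes "0 \<le> x"
  shows "\<bar>cdf (distr \<Omega> borel (\<lambda>\<omega>. mu n p * real (ccc_T n \<omega>))) x
     - (1 - 1 / (1 + stat_moment n) ^ Suc (nat \<lfloor>x / mu n p\<rfloor>))\<bar> \<le> 8 * (q ^ n * (1 + 1 / p))"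
proof -
  have "mu n p * real k \<le> x \<longleftrightarrow> k \<le> nat \<lfloor>x / mu n p\<rfloor>" for k
  proof -
    have "mu n p * real k \<le> x \<longleftrightarrow> real k \<le> x / mu n p"
      using mu_pos by (simp add: field_simps)
    also have "\<dots> \<longleftrightarrow> int k \<le> \<lfloor>x / mu n p\<rfloor>"
      by (simp add: le_floor_iff)
    also have "\<dots> \<longleftrightarrow> k \<le> nat \<lfloor>x / mu n p\<rfloor>"
      using assms mu_pos by (auto simp: nat_le_iff le_nat_iff)
    finally show ?thesis .
  qed
  then show ?thesis
    using prob_T_le_approx by (simp add: cdf_scaled_T)
qed

end

section \<open>Limits as n tends to infinity\<close>

lemma exponential_cdf:
  "cdf (density lborel (exponential_density 1)) x = (if x < 0 then 0 else 1 - exp (- x))"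
  by (simp add: cdf_def measure_def emeasure_erlang_density del: exponential_density_def)
     (simp add: erlang_CDF_def)

text \<open>Applied with v the stationary mass at n and w = 1 - q^n, so that v w is the flow
  \<open>mu\<close>. After taking logarithms the exponent K lies between x/(v w) and x/(v w) + 1,
  and v/(1+v) \<le> ln (1+v) \<le> v squeezes the product to x.\<close>

lemma geometric_tail_limit:
  fixes v w :: "nat \<Rightarrow> real"
  assumes v_pos: "eventually (\<lambda>n. 0 < v n) sequentially" and v: "v \<longlonglongrightarrow> 0"
    and w: "w \<longlonglongrightarrow> 1" and x: "0 \<le> x"
  shows "(\<lambda>n. 1 / (1 + v n) ^ Suc (nat \<lfloor>x / (v n * w n)\<rfloor>)) \<longlonglongrightarrow> exp (- x)"
proof -
  define K where "K n = real (Suc (nat \<lfloor>x / (v n * w n)\<rfloor>))" for n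
  have w_pos: "eventually (\<lambda>n. 0 < w n) sequentially"
    using order_tendstoD(1)[OF w] by simp
  have "(\<lambda>n. K n * ln (1 + v n)) \<longlonglongrightarrow> x"
  proof (rule tendsto_sandwich)
    show "eventually (\<lambda>n. x / w n / (1 + v n) \<le> K n * ln (1 + v n)) sequentially"
      using v_pos w_pos
    proof eventually_elim
      case (elim n)
      have "1 - 1 / (1 + v n) \<le> ln (1 + v n)"
        using ln_le_minus_one[of "1 / (1 + v n)"] elim by (simp add: ln_div)
      then have "v n / (1 + v n) \<le> ln (1 + v n)"
        using elim by (simp add: field_simps)
      moreover have "x / (v n * w n) \<le> K n"
        unfolding K_def by linarith
      ultimately have "(x / (v n * w n)) * (v n / (1 + v n)) \<le> K n * ln (1 + v n)"
        using elim x by (intro mult_mono) (auto simp: K_def)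
      then show ?case using elim by (simp add: field_simps)
    qed
    show "eventually (\<lambda>n. K n * ln (1 + v n) \<le> x / w n + v n) sequentially"
      using v_pos w_pos
    proof eventually_elim
      case (elim n)
      have nonneg: "0 \<le> x / (v n * w n)" using elim x by simp
      then have "K n \<le> x / (v n * w n) + 1"
        unfolding K_def by linarith
      moreover have "ln (1 + v n) \<le> v n"
        using elim by (intro ln_add_one_self_le_self) simp
      ultimately have "K n * ln (1 + v n) \<le> (x / (v n * w n) + 1) * v n"
        using elim nonneg by (intro mult_mono) auto
      also have "(x / (v n * w n) + 1) * v n = x / w n + v n"
        using elim by (simp add: distrib_right)
      finally show ?case .
    qed
    show "(\<lambda>n. x / w n / (1 + v n)) \<longlonglongrightarrow> x"
      using tendsto_divide[OF tendsto_divide[OF tendsto_const[of x] w] tendsto_add[OF tendsto_const[of 1] v]] by simp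
    show "(\<lambda>n. x / w n + v n) \<longlonglongrightarrow> x"
      using tendsto_add[OF tendsto_divide[OF tendsto_const[of x] w] v] by simp
  qed
  then have "(\<lambda>n. exp (- (K n * ln (1 + v n)))) \<longlonglongrightarrow> exp (- x)"
    by (intro tendsto_exp tendsto_minus)
  moreover have "eventually (\<lambda>n. exp (- (K n * ln (1 + v n))) = 1 / (1 + v n) ^ Suc (nat \<lfloor>x / (v n * w n)\<rfloor>)) sequentially"
    using v_pos
  proof eventually_elim
    case (elim n)
    then show ?case
      unfolding K_def by (simp only: exp_minus exp_of_nat_mult inverse_eq_divide) simp
  qed
  ultimately show ?thesis
    by (rule Lim_transform_eventually)
qed

text \<open>Summability of q^(i+1) makes the product converge absolutely, and no factor is 0, so the
  limit may later be divided by.\<close>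

lemma qpoch_inf_limit:
  fixes q :: real
  assumes "0 < q" "q < 1"
  shows "(\<lambda>n. \<Prod>i<n. 1 - q ^ Suc i) \<longlonglongrightarrow> qpoch_inf q" and "qpoch_inf q \<noteq> 0"
proof -
  have "summable (\<lambda>i. norm ((1 - q ^ Suc i) - 1))"
    using assms by (simp add: abs_mult summable_mult summable_geometric)
  then have conv: "convergent_prod (\<lambda>i. 1 - q ^ Suc i)"
    by (intro abs_convergent_prod_imp_convergent_prod summable_imp_abs_convergent_prod)
  then have "(\<lambda>n. \<Prod>i\<le>n. 1 - q ^ Suc i) \<longlonglongrightarrow> qpoch_inf q"
    unfolding qpoch_inf_def by (rule convergent_prod_LIMSEQ)
  then show "(\<lambda>n. \<Prod>i<n. 1 - q ^ Suc i) \<longlonglongrightarrow> qpoch_inf q"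
    by (simp only: LIMSEQ_lessThan_iff_atMost)
  have "q ^ Suc i < 1" for i
    using assms by (intro power_Suc_less_one) auto
  then show "qpoch_inf q \<noteq> 0"
    unfolding qpoch_inf_def by (intro prodinf_nonzero conv) (metis diff_gt_0_iff_gt less_irrefl)
qed

text \<open>The factors depend on n, so the product is compared with the q-Pochhammer product. All
  factors have norm at most 1, hence the products differ by at most the summed factor differences
  (i+1) q^(i+1) / n, which is O(1/n).\<close>

lemma damping_prod_limit:
  fixes q :: real
  assumes q: "0 < q" "q < 1"
  shows "(\<lambda>n. \<Prod>i<n. 1 - q ^ Suc i * (1 - real (Suc i) / n)) \<longlonglongrightarrow> qpoch_inf q"
proof -
  have sum: "summable (\<lambda>i. real (Suc i) * q ^ Suc i)"
  proof -
    have "summable (\<lambda>i. real (Suc i) * q ^ i)"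
      using geometric_deriv_sums[of q] q by (simp add: sums_iff)
    from summable_mult[OF this, of q] show ?thesis by (simp add: mult_ac)
  qed
  define C where "C = (\<Sum>i. real (Suc i) * q ^ Suc i)"
  have diff: "norm ((\<Prod>i<n. 1 - q ^ Suc i * (1 - real (Suc i) / n)) - (\<Prod>i<n. 1 - q ^ Suc i)) \<le> C * inverse (real n)" for n
  proof -
    have qi: "0 \<le> q ^ Suc i" "q ^ Suc i \<le> 1" for i
      using q by (auto intro!: power_le_one simp del: power_Suc)
    have "norm ((\<Prod>i<n. 1 - q ^ Suc i * (1 - real (Suc i) / n)) - (\<Prod>i<n. 1 - q ^ Suc i))
        \<le> (\<Sum>i<n. norm ((1 - q ^ Suc i * (1 - real (Suc i) / n)) - (1 - q ^ Suc i)))"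
    proof (rule norm_prod_diff)
      fix i assume "i \<in> {..<n}"
      then have "0 \<le> 1 - real (Suc i) / n" "1 - real (Suc i) / n \<le> 1" by auto
      then have "0 \<le> q ^ Suc i * (1 - real (Suc i) / n)" "q ^ Suc i * (1 - real (Suc i) / n) \<le> 1"
        using qi[of i] by (auto intro: mult_le_one simp del: power_Suc)
      then show "norm (1 - q ^ Suc i * (1 - real (Suc i) / n)) \<le> 1" by (simp only: real_norm_def abs_le_iff) linarith
      show "norm (1 - q ^ Suc i) \<le> 1" using qi[of i] by (simp only: real_norm_def abs_le_iff) linarith
    qed
    also have "\<dots> = (\<Sum>i<n. real (Suc i) * q ^ Suc i * inverse (real n))"
      using qi by (intro sum.cong refl) (simp add: algebra_simps abs_mult divide_inverse del: power_Suc of_nat_Suc)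
    also have "\<dots> = (\<Sum>i<n. real (Suc i) * q ^ Suc i) * inverse (real n)"
      by (simp only: sum_distrib_right)
    also have "\<dots> \<le> C * inverse (real n)"
      unfolding C_def using qi by (intro mult_right_mono sum_le_suminf sum) (auto simp del: power_Suc)
    finally show ?thesis .
  qed
  have "(\<lambda>n. C * inverse (real n)) \<longlonglongrightarrow> 0"
    by (rule tendsto_mult_right_zero[OF lim_inverse_n])
  then have "(\<lambda>n. (\<Prod>i<n. 1 - q ^ Suc i * (1 - real (Suc i) / n)) - (\<Prod>i<n. 1 - q ^ Suc i)) \<longlonglongrightarrow> 0"
    by (rule Lim_null_comparison[rotated]) (use diff in auto)
  from tendsto_add[OF this qpoch_inf_limit(1)[OF q]] show ?thesis by simp
qed

theorem mainTheorem5: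
  fixes p :: real
  assumes "0 < p" "p < 1"
  defines "q \<equiv> 1 - p"
  shows "weak_conv_m
           (\<lambda>n. distr (ccc_space n p) borel (\<lambda>\<omega>. mu n p * real (ccc_T n \<omega>)))
           (density lborel (exponential_density 1)) \<and>
         (\<lambda>n. mu n p) \<sim>[at_top]
           (\<lambda>n. (1 / qpoch_inf q) * (fact n / real n ^ n) * q ^ (n * (n + 1) div 2))"
proof
  have q: "0 < q" "q < 1" using assms by (auto simp: q_def)
  have ccc: "ccc n p q" if "0 < n" for n
    using assms that by unfold_locales (auto simp: q_def)
  define v where "v n = ccc.stat_moment n q n" for n
  have mu: "mu n p = v n * (1 - q ^ n)" if "0 < n" for n
    unfolding v_def by (rule ccc.mu_eq[OF ccc[OF that]])
  have qn: "(\<lambda>n. q ^ n) \<longlonglongrightarrow> 0"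
    using q by (intro LIMSEQ_power_zero) auto
  have w: "(\<lambda>n. 1 - q ^ n) \<longlonglongrightarrow> 1"
    using tendsto_diff[OF tendsto_const[of 1] qn] by simp
  \<comment> \<open>The locale facts hold only for positive n, so everything below is stated
    eventually.\<close>
  have pos: "eventually (\<lambda>n. 0 < n) (sequentially :: nat filter)"
    by (rule eventually_gt_at_top)
  have v_pos: "eventually (\<lambda>n. 0 < v n) sequentially"
    using pos by eventually_elim (auto simp: v_def intro: ccc.stat_moment_pos[OF ccc])
  have v: "v \<longlonglongrightarrow> 0"
  proof (rule tendsto_sandwich[OF _ _ tendsto_const qn])
    show "eventually (\<lambda>n. 0 \<le> v n) sequentially"
      using v_pos by eventually_elim simp
    show "eventually (\<lambda>n. v n \<le> q ^ n) sequentially"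
      using pos by eventually_elim (auto simp: v_def intro: ccc.stat_moment_le[OF ccc])
  qed

  show "weak_conv_m
           (\<lambda>n. distr (ccc_space n p) borel (\<lambda>\<omega>. mu n p * real (ccc_T n \<omega>)))
           (density lborel (exponential_density 1))"
    unfolding weak_conv_m_def weak_conv_def
  proof (intro allI impI)
    fix x :: real
    let ?F = "\<lambda>n. cdf (distr (ccc_space n p) borel (\<lambda>\<omega>. mu n p * real (ccc_T n \<omega>))) x"
    show "?F \<longlonglongrightarrow> cdf (density lborel (exponential_density 1)) x"
    proof (cases "x < 0")
      case True
      have "eventually (\<lambda>n. 0 = ?F n) sequentially"
        using pos by eventually_elim (simp add: ccc.cdf_scaled_T_neg[OF ccc True])
      then show ?thesis
        using True by (simp add: exponential_cdf Lim_transform_eventually[OF tendsto_const])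
    next
      case False
      then have x: "0 \<le> x" by simp
      \<comment> \<open>The quotient in the floor is x divided by \<open>mu n p\<close>, rewritten
        through v to fit \<open>geometric_tail_limit\<close>.\<close>
      let ?H = "\<lambda>n. 1 - 1 / (1 + v n) ^ Suc (nat \<lfloor>x / (v n * (1 - q ^ n))\<rfloor>)"
      have H: "?H \<longlonglongrightarrow> 1 - exp (- x)"
        by (intro tendsto_diff tendsto_const geometric_tail_limit v_pos v w x)
      have "(\<lambda>n. 8 * (q ^ n * (1 + 1 / p))) \<longlonglongrightarrow> 0"
        using tendsto_mult[OF tendsto_const[of 8] tendsto_mult[OF qn tendsto_const[of "1 + 1 / p"]]] by simp
      moreover have "eventually (\<lambda>n. norm (?F n - ?H n) \<le> 8 * (q ^ n * (1 + 1 / p))) sequentially"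
        using pos
      proof eventually_elim
        case (elim n)
        show ?case
          using ccc.cdf_scaled_T_approx[OF ccc[OF elim] x] unfolding mu[OF elim] v_def real_norm_def .
      qed
      ultimately have "(\<lambda>n. ?F n - ?H n) \<longlonglongrightarrow> 0"
        by (rule Lim_null_comparison[rotated])
      from tendsto_add[OF this H] show ?thesis
        using False by (simp add: exponential_cdf)
    qed
  qed

  let ?R = "\<lambda>n. \<Prod>i<n. 1 - q ^ Suc i * (1 - real (Suc i) / n)"
  let ?g = "\<lambda>n. (1 / qpoch_inf q) * (fact n / real n ^ n) * q ^ (n * (n + 1) div 2)"
  note Q = qpoch_inf_limit(2)[OF q]
  have "(\<lambda>n. qpoch_inf q * (1 - q ^ n) / ?R n) \<longlonglongrightarrow> qpoch_inf q * 1 / qpoch_inf q"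
    by (intro tendsto_divide tendsto_mult tendsto_const w damping_prod_limit q Q)
  then have lim: "(\<lambda>n. qpoch_inf q * (1 - q ^ n) / ?R n) \<longlonglongrightarrow> 1"
    using Q by simp
  \<comment> \<open>The factor n!/n^n q^(n(n+1)/2) is common to \<open>mu\<close> and its claimed
    equivalent and cancels, leaving only the two products and 1 - q^n.\<close>
  have "eventually (\<lambda>n. qpoch_inf q * (1 - q ^ n) / ?R n = mu n p / ?g n) sequentially"
    using pos
  proof eventually_elim
    case (elim n)
    define a where "a = fact n / real n ^ n * q ^ (n * (n + 1) div 2)"
    have a: "a \<noteq> 0" using elim q by (simp add: a_def)
    have "mu n p = a / ?R n * (1 - q ^ n)"
      unfolding mu[OF elim] v_def ccc.stat_moment_top[OF ccc[OF elim]] a_def ..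
    moreover have "?g n = a / qpoch_inf q" by (simp add: a_def)
    moreover have "c * b / r = (a / r * b) / (a / c)" for b c r
      using a by simp
    ultimately show ?case by (simp only:)
  qed
  with lim have "(\<lambda>n. mu n p / ?g n) \<longlonglongrightarrow> 1"
    by (rule Lim_transform_eventually)
  then show "(\<lambda>n. mu n p) \<sim>[at_top] ?g"
    by (rule asymp_equivI')
qed

end
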